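(* Let $R$ be a non-local finite commutative ring with unity. Then the upper ideal relation graph $\Gamma_U(R)$ is a threshold graph if and only if $R$ is isomorphic to $\mathbb{Z}_2 \times \mathbb{F}_q$ for some finite field $\mathbb{F}_q$.
   Context: Rings have a unity. A ring is local if it has a unique maximal ideal; a non-local finite commutative ring is (up to isomorphism) a direct product $R_1\times\cdots\times R_n$ of finite commutative local rings with $n\ge 2$. For $x\in R$, $(x)$ is the ideal generated by $x$. The upper ideal relation graph $\Gamma_U(R)$ is the simple undirected graph whose vertex set is the set of all non-unit elements of $R$ (including $0$), where two distinct vertices $x,y$ are adjacent if and only if there exists a non-unit $z\in R$ with $(x)\subseteq (z)$ and $(y)\subseteq (z)$. $\mathbb{F}_q$ denotes the field with $q$ elements. A threshold graph is a graph which does not contain an induced subgraph isomorphic to $P_4$ (path on 4 vertices), $C_4$ (cycle of length 4) or $2K_2$ (two disjoint edges). *)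

theory Defs
  imports
    "HOL-Algebra.Algebra"
    "HOL-Number_Theory.Residues"
    "Graph_Theory.Graph_Theory"
begin

text \<open>
  The zero ring has no maximal ideal, so it is not local in this sense; it is not a product of
  \<open>n \<ge> 2\<close> local rings either.  Non-locality therefore has to be combined with
  \<open>\<one> \<noteq> \<zero>\<close>.
\<close>

definition local_ring :: "('a, 'm) ring_scheme \<Rightarrow> bool" where
  "local_ring R \<longleftrightarrow> (\<exists>!M. maximalideal M R)"

text \<open>
  As for the library's locale \<^locale>\<open>pair_graph\<close>, a simple undirected graph is a loop-free
  symmetric digraph: the undirected edge between \<open>x\<close> and \<open>y\<close> is the pair of
  arcs \<open>(x, y)\<close>, \<open>(y, x)\<close>.
\<close>

definition undirected :: "'a set \<Rightarrow> 'a rel \<Rightarrow> 'a pair_pre_digraph" where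
  "undirected V E = \<lparr>pverts = V, parcs = E \<union> E\<inverse>\<rparr>"

definition graph_P4 :: "nat pair_pre_digraph" where
  "graph_P4 = undirected {0, 1, 2, 3} {(0, 1), (1, 2), (2, 3)}"

definition graph_C4 :: "nat pair_pre_digraph" where
  "graph_C4 = undirected {0, 1, 2, 3} {(0, 1), (1, 2), (2, 3), (3, 0)}"

definition graph_2K2 :: "nat pair_pre_digraph" where
  "graph_2K2 = undirected {0, 1, 2, 3} {(0, 1), (2, 3)}"

text \<open>
  As a vertex-level condition this is lemma \<open>has_induced_copy_iff\<close> below.
\<close>

definition has_induced_copy :: "'a pair_pre_digraph \<Rightarrow> 'b pair_pre_digraph \<Rightarrow> bool" where
  "has_induced_copy G F \<longleftrightarrow>
     (\<exists>H. induced_subgraph H (with_proj G) \<and> digraph_iso H (with_proj F))"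

definition threshold_graph :: "'a pair_pre_digraph \<Rightarrow> bool" where
  "threshold_graph G \<longleftrightarrow> pair_graph G \<and>
     \<not> has_induced_copy G graph_P4 \<and>
     \<not> has_induced_copy G graph_C4 \<and>
     \<not> has_induced_copy G graph_2K2"

definition nonunits :: "('a, 'm) ring_scheme \<Rightarrow> 'a set" where
  "nonunits R = carrier R - Units R"

definition upper_ideal_relation_graph :: "('a, 'm) ring_scheme \<Rightarrow> 'a pair_pre_digraph" where
  "upper_ideal_relation_graph R =
     \<lparr>pverts = nonunits R,
      parcs = {(x, y). x \<in> nonunits R \<and> y \<in> nonunits R \<and> x \<noteq> y \<and>
                 (\<exists>z \<in> nonunits R. Idl\<^bsub>R\<^esub> {x} \<subseteq> Idl\<^bsub>R\<^esub> {z} \<and> Idl\<^bsub>R\<^esub> {y} \<subseteq> Idl\<^bsub>R\<^esub> {z})}\<rparr>"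

lemma pair_graph_undirected:
  assumes "finite V" and "E \<subseteq> V \<times> V" and "irrefl E"
  shows "pair_graph (undirected V E)"
proof -
  have "finite E"
    using assms(1,2) finite_subset by fastforce
  then show ?thesis
    using assms
    by unfold_locales (auto simp: undirected_def symmetric_def irrefl_def intro!: symI)
qed

lemma pair_graph_P4: "pair_graph graph_P4"
  unfolding graph_P4_def by (rule pair_graph_undirected) (auto simp: irrefl_def)

lemma pair_graph_C4: "pair_graph graph_C4"
  unfolding graph_C4_def by (rule pair_graph_undirected) (auto simp: irrefl_def)

lemma pair_graph_2K2: "pair_graph graph_2K2"
  unfolding graph_2K2_def by (rule pair_graph_undirected) (auto simp: irrefl_def)

lemma pair_graph_upper_ideal_relation_graph:
  assumes "finite (carrier R)"
  shows "pair_graph (upper_ideal_relation_graph R)"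
proof -
  let ?G = "upper_ideal_relation_graph R"
  have fin: "finite (nonunits R)"
    using assms by (simp add: nonunits_def)
  have sub: "parcs ?G \<subseteq> nonunits R \<times> nonunits R"
    by (auto simp: upper_ideal_relation_graph_def)
  have "finite (parcs ?G)"
    using finite_subset[OF sub] fin by simp
  moreover have "sym (parcs ?G)"
    by (auto simp: upper_ideal_relation_graph_def intro!: symI)
  ultimately show ?thesis
    using fin
    by unfold_locales (auto simp: upper_ideal_relation_graph_def symmetric_def)
qed

lemma has_induced_copy_iff:
  assumes "pair_wf_digraph G" and "pair_wf_digraph F"
  shows "has_induced_copy G F \<longleftrightarrow>
    (\<exists>f. inj_on f (pverts F) \<and> f ` pverts F \<subseteq> pverts G \<and>
       (\<forall>u\<in>pverts F. \<forall>v\<in>pverts F. (f u, f v) \<in> parcs G \<longleftrightarrow> (u, v) \<in> parcs F))"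
  (is "?L \<longleftrightarrow> ?R")
proof -
  interpret G: pair_wf_digraph G by fact
  interpret F: pair_wf_digraph F by fact
  show ?thesis
  proof
    assume ?L
    then obtain H where ind: "induced_subgraph H (with_proj G)" and iso: "digraph_iso H (with_proj F)"
      by (auto simp: has_induced_copy_def)
    have wfH: "wf_digraph H" and sub: "verts H \<subseteq> pverts G"
      and tl: "tail H = fst" "head H = snd"
      and arcH: "arcs H = {e \<in> parcs G. fst e \<in> verts H \<and> snd e \<in> verts H}"
      using ind by (auto simp: induced_subgraph_def subgraph_def compatible_def)
    obtain h where h: "pre_digraph.digraph_isomorphism H h" and F: "with_proj F = app_iso h H"
      using iso by (auto simp: digraph_iso_def)
    have VF: "pverts F = iso_verts h ` verts H" and AF: "parcs F = iso_arcs h ` arcs H"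
      and it: "iso_tail h = fst" and ih: "iso_head h = snd"
      using F by (auto simp: with_proj_def app_iso_def)
    have inj: "inj_on (iso_verts h) (verts H)"
      and ends: "\<And>a. a \<in> arcs H \<Longrightarrow> iso_arcs h a = (iso_verts h (fst a), iso_verts h (snd a))"
      using h unfolding pre_digraph.digraph_isomorphism_def tl it ih
      by (auto simp: prod_eq_iff)
    define f where "f = the_inv_into (verts H) (iso_verts h)"
    have fv: "f (iso_verts h x) = x" if "x \<in> verts H" for x
      using that inj by (simp add: f_def the_inv_into_f_f)
    have "inj_on f (pverts F)"
      unfolding VF by (auto simp: inj_on_def fv)
    moreover have "f ` pverts F \<subseteq> pverts G"
      unfolding VF using sub by (auto simp: fv)
    moreover have "(f u, f v) \<in> parcs G \<longleftrightarrow> (u, v) \<in> parcs F"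
      if uv: "u \<in> pverts F" "v \<in> pverts F" for u v
    proof -
      obtain x y where xy: "x \<in> verts H" "y \<in> verts H" "u = iso_verts h x" "v = iso_verts h y"
        using uv VF by auto
      have "(u, v) \<in> parcs F \<longleftrightarrow> (x, y) \<in> arcs H"
      proof
        assume "(u, v) \<in> parcs F"
        then obtain a where a: "a \<in> arcs H" "(u, v) = iso_arcs h a" using AF by auto
        then have "fst a \<in> verts H" "snd a \<in> verts H" unfolding arcH by simp_all
        moreover have "iso_verts h (fst a) = iso_verts h x" "iso_verts h (snd a) = iso_verts h y"
          using a ends[OF a(1)] xy(3,4) by simp_all
        ultimately have "fst a = x" "snd a = y" using inj xy(1,2) by (meson inj_onD)+
        then show "(x, y) \<in> arcs H" using a by auto
      next
        assume a: "(x, y) \<in> arcs H"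
        then have "iso_arcs h (x, y) = (u, v)" by (simp add: ends xy(3,4))
        then show "(u, v) \<in> parcs F" using a unfolding AF by (metis imageI)
      qed
      moreover have "(x, y) \<in> arcs H \<longleftrightarrow> (x, y) \<in> parcs G"
        by (subst arcH) (simp add: xy(1,2))
      ultimately show ?thesis by (simp add: xy fv)
    qed
    ultimately show ?R by blast
  next
    assume ?R
    then obtain f where inj: "inj_on f (pverts F)" and im: "f ` pverts F \<subseteq> pverts G"
      and adj: "\<And>u v. u \<in> pverts F \<Longrightarrow> v \<in> pverts F \<Longrightarrow> (f u, f v) \<in> parcs G \<longleftrightarrow> (u, v) \<in> parcs F"
      by blast
    define h :: "('a, 'a \<times> 'a, 'b, 'b \<times> 'b) digraph_isomorphism" where
      "h = (let g = the_inv_into (pverts F) f in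
        \<lparr>iso_verts = g, iso_arcs = map_prod g g, iso_head = snd, iso_tail = fst\<rparr>)"
    define H where "H = with_proj \<lparr>pverts = f ` pverts F,
      parcs = {e \<in> parcs G. fst e \<in> f ` pverts F \<and> snd e \<in> f ` pverts F}\<rparr>"
    have g: "the_inv_into (pverts F) f (f x) = x" if "x \<in> pverts F" for x
      using that inj by (simp add: the_inv_into_f_f)
    have wfH: "wf_digraph H"
      by (auto simp: wf_digraph_def H_def)
    have "induced_subgraph H (with_proj G)"
      using wfH im G.wf_digraph
      by (auto simp: induced_subgraph_def subgraph_def compatible_def H_def)
    moreover have "pre_digraph.digraph_isomorphism H h"
      unfolding pre_digraph.digraph_isomorphism_def
      using wfH by (auto simp: h_def H_def Let_def inj_on_def g)
    moreover have "with_proj F = app_iso h H"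
    proof -
      have "parcs F = iso_arcs h ` arcs H"
      proof (intro equalityI subsetI)
        fix e assume e: "e \<in> parcs F"
        obtain u v where uv: "e = (u, v)" by (cases e)
        then have "u \<in> pverts F" "v \<in> pverts F" using e F.wellformed' by auto
        moreover from this have "(f u, f v) \<in> arcs H" using adj e uv by (auto simp: H_def)
        moreover have "e = iso_arcs h (f u, f v)" using calculation uv by (simp add: h_def Let_def g)
        ultimately show "e \<in> iso_arcs h ` arcs H" by blast
      next
        fix e assume "e \<in> iso_arcs h ` arcs H"
        then show "e \<in> parcs F" using adj by (auto simp: h_def H_def Let_def g)
      qed
      moreover have "pverts F = iso_verts h ` verts H"
        by (auto simp: h_def H_def Let_def g image_image)
      moreover have "iso_tail h = fst" "iso_head h = snd"
        by (simp_all add: h_def Let_def)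
      ultimately show ?thesis
        by (intro pre_digraph.equality)
          (simp_all only: app_iso_simps with_proj_simps pre_digraph.simps, simp)
    qed
    ultimately show ?L unfolding has_induced_copy_def digraph_iso_def by blast
  qed
qed

text \<open>
  Every finite field has an isomorphic copy whose elements are natural numbers, so quantifying over
  finite fields of type \<^typ>\<open>nat ring\<close> loses nothing.
\<close>

lemma finite_field_nat_copy:
  fixes K :: "('a, 'm) ring_scheme"
  assumes "field K" and "finite (carrier K)"
  shows "\<exists>F :: nat ring. field F \<and> finite (carrier F) \<and> K \<simeq> F"
proof -
  interpret field K by fact
  obtain f :: "'a \<Rightarrow> nat" where inj: "inj_on f (carrier K)"
    using finite_imp_inj_to_nat_seg[OF assms(2)] by blast
  have "field (image_ring f K)"
    using inj_imp_image_ring_is_field[OF inj] .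
  moreover have "finite (carrier (image_ring f K))"
    using assms(2) by (simp add: image_ring_carrier)
  moreover have "K \<simeq> image_ring f K"
    using inj_imp_image_ring_iso[OF inj] by (auto simp: is_ring_iso_def)
  ultimately show ?thesis by blast
qed

end

theory Submission
  imports Defs
begin

text \<open>
  In a finite commutative ring that is not local, some element has a power that is an idempotent
  other than \<open>0\<close> and \<open>1\<close>, so \<open>1 = e + f\<close> with \<open>e\<close> and \<open>f\<close> orthogonal and nonzero.  A non-unit
  dividing \<open>e\<close> is adjacent to \<open>e\<close>, a non-unit dividing \<open>f\<close> is adjacent to \<open>f\<close>, and comaximal
  elements are never adjacent; hence, if there is no induced \<open>2K\<^sub>2\<close>, one of the idempotents, say
  \<open>e\<close>, is the only non-unit dividing it.  This makes \<open>f R\<close> a field and leaves \<open>e R\<close> with a single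
  unit.  If \<open>e R\<close> were not \<open>{0, e}\<close>, then \<open>e\<close> would split further, and three orthogonal idempotents
  yield an induced \<open>P\<^sub>4\<close>.  Conversely, in \<open>\<int>\<^sub>2 \<times> F\<close> all non-units except \<open>(1, 0)\<close> are pairwise
  adjacent, and none of the forbidden graphs becomes complete on removing one vertex.
\<close>

section \<open>Threshold graphs\<close>

lemma pair_wf_digraph_if_pair_graph: "pair_graph G \<Longrightarrow> pair_wf_digraph G"
  by (simp add: pair_graph_def pair_digraph_def pair_fin_digraph_def)

text \<open>
  In each of the forbidden graphs \<open>{0, 2}\<close> and \<open>{1, 3}\<close> are non-edges.  In an induced copy one
  of them avoids \<open>w\<close>.
\<close>

lemma not_has_induced_copy_if_clique_but_one:
  fixes F :: "nat pair_pre_digraph"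
  assumes "pair_graph G" and "pair_graph F"
    and clique: "\<And>x y. \<lbrakk>x \<in> pverts G - {w}; y \<in> pverts G - {w}; x \<noteq> y\<rbrakk> \<Longrightarrow> (x, y) \<in> parcs G"
    and F: "pverts F = {0, 1, 2, 3}" "(0, 2) \<notin> parcs F" "(1, 3) \<notin> parcs F"
  shows "\<not> has_induced_copy G F"
proof
  assume "has_induced_copy G F"
  then obtain f where inj: "inj_on f (pverts F)" and im: "f ` pverts F \<subseteq> pverts G"
    and adj: "\<And>u v. \<lbrakk>u \<in> pverts F; v \<in> pverts F\<rbrakk> \<Longrightarrow> (f u, f v) \<in> parcs G \<longleftrightarrow> (u, v) \<in> parcs F"
    using has_induced_copy_iff[of G F] assms(1,2)[THEN pair_wf_digraph_if_pair_graph] by blast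
  have "(f 0, f 2) \<notin> parcs G" "(f 1, f 3) \<notin> parcs G"
    using adj F by auto
  moreover have "distinct [f 0, f 1, f 2, f 3]"
    using inj unfolding F by (auto simp: inj_on_def)
  moreover have "f i \<in> pverts G" if "i \<in> {0, 1, 2, 3}" for i
    using im that unfolding F by blast
  ultimately show False
    using clique[of "f 0" "f 2"] clique[of "f 1" "f 3"] by (cases "w \<in> {f 0, f 2}") auto
qed

lemma threshold_graph_if_clique_but_one:
  assumes "pair_graph G"
    and clique: "\<And>x y. \<lbrakk>x \<in> pverts G - {w}; y \<in> pverts G - {w}; x \<noteq> y\<rbrakk> \<Longrightarrow> (x, y) \<in> parcs G"
  shows "threshold_graph G"
proof -
  note copy = not_has_induced_copy_if_clique_but_one[OF assms(1) _ clique]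
  have "\<not> has_induced_copy G graph_P4"
    by (rule copy[OF pair_graph_P4]) (auto simp: graph_P4_def undirected_def)
  moreover have "\<not> has_induced_copy G graph_C4"
    by (rule copy[OF pair_graph_C4]) (auto simp: graph_C4_def undirected_def)
  moreover have "\<not> has_induced_copy G graph_2K2"
    by (rule copy[OF pair_graph_2K2]) (auto simp: graph_2K2_def undirected_def)
  ultimately show ?thesis using assms(1) by (simp add: threshold_graph_def)
qed

text \<open>Six pairs suffice: both graphs are symmetric, which settles the reversed pairs, and
  loop-free, which settles the diagonal.\<close>

lemma has_induced_copyI:
  fixes F :: "nat pair_pre_digraph"
  assumes "pair_graph G" and "pair_graph F" and F: "pverts F = {0, 1, 2, 3}"
    and abcd: "distinct [a, b, c, d]" "{a, b, c, d} \<subseteq> pverts G"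
    and adj: "(a, b) \<in> parcs G \<longleftrightarrow> (0, 1) \<in> parcs F" "(a, c) \<in> parcs G \<longleftrightarrow> (0, 2) \<in> parcs F"
      "(a, d) \<in> parcs G \<longleftrightarrow> (0, 3) \<in> parcs F" "(b, c) \<in> parcs G \<longleftrightarrow> (1, 2) \<in> parcs F"
      "(b, d) \<in> parcs G \<longleftrightarrow> (1, 3) \<in> parcs F" "(c, d) \<in> parcs G \<longleftrightarrow> (2, 3) \<in> parcs F"
  shows "has_induced_copy G F"
proof -
  interpret G: pair_graph G by fact
  interpret F: pair_graph F by fact
  have sG: "(x, y) \<in> parcs G \<longleftrightarrow> (y, x) \<in> parcs G" for x y
    using G.sym_arcs by (auto simp: symmetric_def dest: symD)
  have sF: "(x, y) \<in> parcs F \<longleftrightarrow> (y, x) \<in> parcs F" for x y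
    using F.sym_arcs by (auto simp: symmetric_def dest: symD)
  have loops: "(x, x) \<notin> parcs G" "(y, y) \<notin> parcs F" for x y
    using G.no_loops' F.no_loops' by blast+
  note sw = sG[of b a] sG[of c a] sG[of d a] sG[of c b] sG[of d b] sG[of d c]
    sF[of 1 0] sF[of 2 0] sF[of 3 0] sF[of 2 1] sF[of 3 1] sF[of 3 2]
  define f where "f = (\<lambda>i. [a, b, c, d] ! i)"
  have f: "f 0 = a" "f 1 = b" "f 2 = c" "f 3 = d" by (simp_all add: f_def)
  have "inj_on f (pverts F)" using abcd(1) f by (simp add: F)
  moreover have "f ` pverts F \<subseteq> pverts G" using abcd(2) f by (simp add: F)
  moreover have "\<forall>u\<in>pverts F. \<forall>v\<in>pverts F. (f u, f v) \<in> parcs G \<longleftrightarrow> (u, v) \<in> parcs F"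
    unfolding F ball_simps f using adj sw loops by blast
  ultimately show ?thesis
    using has_induced_copy_iff assms(1,2)[THEN pair_wf_digraph_if_pair_graph] by blast
qed

lemma threshold_graph_no_P4:
  assumes "threshold_graph G" and "distinct [a, b, c, d]"
    and e: "(a, b) \<in> parcs G" "(b, c) \<in> parcs G" "(c, d) \<in> parcs G"
  shows "(a, c) \<in> parcs G \<or> (a, d) \<in> parcs G \<or> (b, d) \<in> parcs G"
proof (rule ccontr)
  assume n: "\<not> ?thesis"
  have G: "pair_graph G" using assms(1) by (simp add: threshold_graph_def)
  interpret pair_graph G by fact
  have "{a, b, c, d} \<subseteq> pverts G" using e wellformed' by blast
  then have "has_induced_copy G graph_P4"
    using assms(2) n e
    by (intro has_induced_copyI[OF G pair_graph_P4, of a b c d])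
      (auto simp: graph_P4_def undirected_def)
  then show False using assms(1) by (simp add: threshold_graph_def)
qed

lemma threshold_graph_no_2K2:
  assumes "threshold_graph G" and "distinct [a, b, c, d]"
    and e: "(a, b) \<in> parcs G" "(c, d) \<in> parcs G"
  shows "(a, c) \<in> parcs G \<or> (a, d) \<in> parcs G \<or> (b, c) \<in> parcs G \<or> (b, d) \<in> parcs G"
proof (rule ccontr)
  assume n: "\<not> ?thesis"
  have G: "pair_graph G" using assms(1) by (simp add: threshold_graph_def)
  interpret pair_graph G by fact
  have "{a, b, c, d} \<subseteq> pverts G" using e wellformed' by blast
  then have "has_induced_copy G graph_2K2"
    using assms(2) n e
    by (intro has_induced_copyI[OF G pair_graph_2K2, of a b c d])
      (auto simp: graph_2K2_def undirected_def)
  then show False using assms(1) by (simp add: threshold_graph_def)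
qed

section \<open>Idempotents\<close>

context monoid
begin

text \<open>By finiteness two powers agree, \<open>x [^] i = x [^] (i + p)\<close>, so the powers
  have period \<open>p\<close> from exponent \<open>i\<close> on. An exponent that is a multiple of
  \<open>p\<close> and at least \<open>i\<close> can be doubled without changing the power.\<close>

lemma exists_idempotent_power:
  assumes "finite (carrier G)" and x: "x \<in> carrier G"
  shows "\<exists>n>0. x [^] (n::nat) \<otimes> x [^] n = x [^] n"
proof -
  have "\<not> inj (\<lambda>n::nat. x [^] n)"
    using finite_imageD[of "\<lambda>n::nat. x [^] n" UNIV] x
      finite_subset[OF _ assms(1), of "range (\<lambda>n::nat. x [^] n)"] by auto
  then obtain i j :: nat where ij: "i < j" "x [^] i = x [^] j"
    by (metis injI linorder_neqE_nat)
  define p where "p = j - i"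
  have p: "0 < p" "j = i + p" using ij by (auto simp: p_def)
  have 1: "x [^] (m + p) = x [^] m" if "i \<le> m" for m
  proof -
    have "x [^] (m + p) = x [^] j \<otimes> x [^] (m - i)"
      using that p x by (simp add: nat_pow_mult add.commute)
    also have "\<dots> = x [^] m" using that x by (simp flip: ij(2) add: nat_pow_mult)
    finally show ?thesis .
  qed
  have 2: "x [^] (m + k * p) = x [^] m" if "i \<le> m" for m k
    using that
  proof (induction k)
    case (Suc k)
    then have "x [^] (m + k * p + p) = x [^] m" using 1[of "m + k * p"] by simp
    then show ?case by (simp add: add.commute add.left_commute)
  qed simp
  \<comment> \<open>\<open>Suc i\<close> instead of \<open>i\<close> keeps the exponent positive
    when \<open>i = 0\<close>.\<close>
  have "i \<le> Suc i * p" using p(1) by (cases p) simp_all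
  then have "x [^] (Suc i * p) \<otimes> x [^] (Suc i * p) = x [^] (Suc i * p)"
    using 2[of "Suc i * p" "Suc i"] x by (simp add: nat_pow_mult)
  moreover have "0 < Suc i * p" using p by simp
  ultimately show ?thesis by blast
qed

end

section \<open>Units, nilpotent elements and locality\<close>

context cring
begin

text \<open>The quotient is the geometric sum, built up by
  \<open>1 - x^(n+1) = (1 - x) + (1 - x^n) x\<close>.\<close>

lemma one_minus_divides_one_minus_pow:
  assumes x: "x \<in> carrier R"
  shows "(\<one> \<ominus> x) divides (\<one> \<ominus> x [^] (n::nat))"
proof (induction n)
  case 0
  have "\<one> \<ominus> \<one> = (\<one> \<ominus> x) \<otimes> \<zero>" using x by algebra
  then show ?case by (intro dividesI[where c = \<zero>]) auto
next
  case (Suc n)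
  then obtain c where c: "c \<in> carrier R" "\<one> \<ominus> x [^] n = (\<one> \<ominus> x) \<otimes> c" by blast
  have p: "x [^] n \<in> carrier R" using x by simp
  have "\<one> \<ominus> x [^] n \<otimes> x = (\<one> \<ominus> x) \<oplus> (\<one> \<ominus> x [^] n) \<otimes> x" using x p by algebra
  also have "\<dots> = (\<one> \<ominus> x) \<otimes> (\<one> \<oplus> c \<otimes> x)" using x c(1) unfolding c(2) by algebra
  finally show ?case using x c(1) by auto
qed

lemma divides_one_iff_Units:
  assumes x: "x \<in> carrier R"
  shows "x divides \<one> \<longleftrightarrow> x \<in> Units R"
proof
  assume "x divides \<one>"
  then obtain c where "c \<in> carrier R" "\<one> = x \<otimes> c" by blast
  then show "x \<in> Units R" using x m_comm[of c x] unfolding Units_def by auto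
next
  assume "x \<in> Units R"
  then show "x divides \<one>" by (intro dividesI[where c = "inv x"]) simp_all
qed

text \<open>\<open>\<one> \<ominus> x\<close> divides \<open>\<one> \<ominus> x [^] n\<close>, which
  here is \<open>\<one>\<close>.\<close>

lemma nilpotent_imp_one_minus_Units:
  assumes "x \<in> carrier R" and "x [^] (n::nat) = \<zero>"
  shows "\<one> \<ominus> x \<in> Units R"
proof -
  have "\<one> \<ominus> \<zero> = \<one>" by algebra
  then show ?thesis
    using one_minus_divides_one_minus_pow[of x n] assms divides_one_iff_Units[of "\<one> \<ominus> x"]
    by (simp only: minus_closed one_closed)
qed

lemma nonunits_closed: "x \<in> nonunits R \<Longrightarrow> x \<in> carrier R"
  by (simp add: nonunits_def)

lemma nonunit_divides_iff:
  "z \<in> carrier R \<Longrightarrow> z \<in> nonunits R \<longleftrightarrow> \<not> z divides \<one>"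
  by (simp add: nonunits_def divides_one_iff_Units)

lemma nonunits_mult:
  assumes "x \<in> nonunits R" and "y \<in> carrier R"
  shows "x \<otimes> y \<in> nonunits R"
proof -
  have x: "x \<in> carrier R" using assms by (simp add: nonunits_closed)
  have "x divides \<one>" if "x \<otimes> y divides \<one>"
    using divides_trans[OF _ that x] x assms(2) by blast
  then show ?thesis using assms x by (auto simp: nonunit_divides_iff)
qed

text \<open>The non-units form an ideal: if \<open>x \<oplus> y\<close> had inverse
  \<open>t\<close>, then \<open>x \<otimes> t\<close> would be nilpotent and
  \<open>y \<otimes> t = \<one> \<ominus> x \<otimes> t\<close> a unit, although \<open>y\<close> is
  a non-unit. Every proper ideal consists of non-units, so this ideal is the only maximal
  one.\<close>

lemma local_ring_if_nonunits_nilpotent: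
  assumes "\<one> \<noteq> \<zero>"
    and nil: "\<And>x. x \<in> nonunits R \<Longrightarrow> \<exists>n::nat. x [^] n = \<zero>"
  shows "local_ring R"
proof -
  have z: "\<zero> \<in> nonunits R" using assms(1) by (auto simp: nonunit_divides_iff factor_def)
  have add: "x \<oplus> y \<in> nonunits R" if xy: "x \<in> nonunits R" "y \<in> nonunits R" for x y
  proof (rule ccontr)
    have c: "x \<in> carrier R" "y \<in> carrier R" using xy by (simp_all add: nonunits_closed)
    assume "x \<oplus> y \<notin> nonunits R"
    then obtain t where t: "t \<in> carrier R" "(x \<oplus> y) \<otimes> t = \<one>"
      using c by (auto simp: nonunit_divides_iff)
    obtain n :: nat where "(x \<otimes> t) [^] n = \<zero>" using nil nonunits_mult xy(1) t(1) by blast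
    then have "\<one> \<ominus> x \<otimes> t \<in> Units R" using c t by (intro nilpotent_imp_one_minus_Units) auto
    moreover have "\<one> \<ominus> x \<otimes> t = y \<otimes> t" using c t(1) unfolding t(2)[symmetric] by algebra
    moreover have "y \<otimes> t \<in> nonunits R" using nonunits_mult xy(2) t(1) by blast
    ultimately show False by (simp add: nonunits_def)
  qed
  have minus: "\<ominus> x \<in> nonunits R" if "x \<in> nonunits R" for x
  proof -
    have "\<ominus> x = x \<otimes> \<ominus> \<one>" using nonunits_closed[OF that] by algebra
    then show ?thesis using nonunits_mult[OF that] by simp
  qed
  have id: "ideal (nonunits R) R"
  proof (rule idealI[OF ring_axioms])
    show "subgroup (nonunits R) (add_monoid R)"
      using z add minus by (intro add.subgroupI) (auto simp: nonunits_def a_inv_def)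
  qed (use nonunits_mult m_comm nonunits_closed in metis)+
  have sub: "J \<subseteq> nonunits R" if J: "ideal J R" "J \<noteq> carrier R" for J
  proof
    fix x assume x: "x \<in> J"
    then have xc: "x \<in> carrier R" using ideal.Icarr[OF J(1)] by simp
    have "\<one> \<notin> J" using J ideal.one_imp_carrier by blast
    then show "x \<in> nonunits R" using ideal.I_r_closed[OF J(1) x] xc
      by (auto simp: nonunit_divides_iff factor_def)
  qed
  have ne: "carrier R \<noteq> nonunits R" using one_closed by (auto simp: nonunits_def)
  have "maximalideal (nonunits R) R"
    using id ne sub by (intro maximalidealI) auto
  moreover have "M = nonunits R" if "maximalideal M R" for M
  proof -
    interpret M: maximalideal M R by fact
    have "M \<subseteq> nonunits R" using sub M.is_ideal M.I_notcarr by metis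
    then show ?thesis using M.I_maximal[OF id] ne by (auto simp: nonunits_def)
  qed
  ultimately show ?thesis unfolding local_ring_def by blast
qed

text \<open>Non-locality yields a non-unit \<open>x\<close> that is not nilpotent. Its idempotent
  power \<open>e\<close> is then neither zero nor one, and \<open>f\<close> is
  \<open>\<one> \<ominus> e\<close>.\<close>

lemma nonlocal_obtains_idempotents:
  assumes "finite (carrier R)" and "\<one> \<noteq> \<zero>" and "\<not> local_ring R"
  obtains e f where "e \<in> carrier R" "f \<in> carrier R" "e \<noteq> \<zero>" "f \<noteq> \<zero>" "e \<otimes> f = \<zero>" "e \<oplus> f = \<one>"
proof -
  obtain x where x: "x \<in> nonunits R" "\<And>n::nat. x [^] n \<noteq> \<zero>"
    using local_ring_if_nonunits_nilpotent[OF assms(2)] assms(3) by fast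
  have xc: "x \<in> carrier R" using x(1) by (simp add: nonunits_closed)
  obtain n :: nat where n: "0 < n" "x [^] n \<otimes> x [^] n = x [^] n"
    using exists_idempotent_power[OF assms(1) xc] by blast
  define e where "e = x [^] n"
  have e: "e \<in> carrier R" "e \<otimes> e = e" "e \<noteq> \<zero>" using n x xc by (simp_all add: e_def)
  have "e \<noteq> \<one>"
  proof
    assume "e = \<one>"
    \<comment> \<open>As \<open>n > 0\<close>, a factor \<open>x\<close> splits off, so
      \<open>x\<close> would be a unit.\<close>
    then have "x \<otimes> x [^] (n - 1) = \<one>"
      using n(1) xc nat_pow_mult[OF xc, of 1 "n - 1"] by (simp add: e_def)
    then have "x divides \<one>" using xc by (intro dividesI[where c = "x [^] (n - 1)"]) simp_all
    then show False using x(1) xc by (simp add: nonunit_divides_iff)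
  qed
  show thesis
  proof (rule that[of e "\<one> \<ominus> e"])
    show "\<one> \<ominus> e \<noteq> \<zero>" using e(1) \<open>e \<noteq> \<one>\<close> by simp
    have "e \<otimes> (\<one> \<ominus> e) = e \<ominus> e \<otimes> e" using e(1) by algebra
    then show "e \<otimes> (\<one> \<ominus> e) = \<zero>" using e by simp
    show "e \<oplus> (\<one> \<ominus> e) = \<one>" using e(1) by algebra
  qed (use e in auto)
qed

end

section \<open>The upper ideal relation graph\<close>

context cring
begin

lemma pverts_upper_ideal_relation_graph [simp]:
  "pverts (upper_ideal_relation_graph R) = nonunits R"
  by (simp add: upper_ideal_relation_graph_def)

text \<open>For principal ideals, containment is divisibility reversed, so arcs can be handled
  through common non-unit divisors.\<close>

lemma upper_ideal_relation_graph_arc_iff: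
  "(x, y) \<in> parcs (upper_ideal_relation_graph R) \<longleftrightarrow>
    x \<in> nonunits R \<and> y \<in> nonunits R \<and> x \<noteq> y \<and>
    (\<exists>z\<in>nonunits R. z divides x \<and> z divides y)"
proof -
  have "Idl {x} \<subseteq> Idl {z} \<longleftrightarrow> z divides x" if "x \<in> nonunits R" "z \<in> nonunits R" for x z
    using that by (simp add: nonunits_closed to_contain_is_to_divide flip: cgenideal_eq_genideal)
  then show ?thesis by (auto simp: upper_ideal_relation_graph_def)
qed

text \<open>A common divisor of \<open>x\<close> and \<open>y\<close> divides the combination
  \<open>\<one>\<close>, so it is a unit; if \<open>x = y\<close>, then \<open>x\<close> itself
  would be a common non-unit divisor.\<close>

lemma comaximal_not_arc:
  assumes "x \<in> nonunits R" and "s \<in> carrier R" "t \<in> carrier R" and "x \<otimes> s \<oplus> y \<otimes> t = \<one>"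
  shows "x \<noteq> y" and "(x, y) \<notin> parcs (upper_ideal_relation_graph R)"
proof -
  have *: "\<not> (z divides x \<and> z divides y)" if z: "z \<in> nonunits R" for z
  proof
    assume "z divides x \<and> z divides y"
    then obtain c d where cd: "c \<in> carrier R" "x = z \<otimes> c" "d \<in> carrier R" "y = z \<otimes> d"
      by blast
    have zc: "z \<in> carrier R" using z by (rule nonunits_closed)
    have "x \<otimes> s \<oplus> y \<otimes> t = z \<otimes> (c \<otimes> s \<oplus> d \<otimes> t)"
      unfolding cd(2,4) using zc cd(1,3) assms(2,3) by algebra
    then have "z divides \<one>" using assms cd by (intro dividesI[where c = "c \<otimes> s \<oplus> d \<otimes> t"]) simp_all
    then show False using z zc by (simp add: nonunit_divides_iff)
  qed
  show "x \<noteq> y" using *[OF assms(1)] assms(1) by (auto simp: nonunits_closed)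
  show "(x, y) \<notin> parcs (upper_ideal_relation_graph R)"
    using * by (auto simp: upper_ideal_relation_graph_arc_iff)
qed

section \<open>Orthogonal idempotents as vertices\<close>

lemma zero_divisor_nonunit:
  assumes "x \<in> carrier R" "y \<in> carrier R" and "x \<otimes> y = \<zero>" and "y \<noteq> \<zero>"
  shows "x \<in> nonunits R"
proof (rule ccontr)
  assume "x \<notin> nonunits R"
  then have "x divides \<one>" using assms(1) by (simp add: nonunit_divides_iff)
  then obtain c where c: "c \<in> carrier R" "\<one> = x \<otimes> c" by blast
  have "y = (x \<otimes> c) \<otimes> y" using assms(2) by (simp flip: c(2))
  also have "\<dots> = (x \<otimes> y) \<otimes> c" using assms(1,2) c(1) by algebra
  finally show False using assms(3,4) c(1) by simp
qed

lemma idempotent_if_complementary: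
  assumes "e \<in> carrier R" "f \<in> carrier R" "e \<otimes> f = \<zero>" "e \<oplus> f = \<one>"
  shows "e \<otimes> e = e"
proof -
  have "e \<otimes> e \<oplus> e \<otimes> f = e \<otimes> (e \<oplus> f)" using assms(1,2) by algebra
  then show ?thesis using assms by simp
qed

text \<open>
  The path is \<open>a + b, a, c, b + c\<close>.
\<close>

lemma threshold_no_three_orthogonal_idempotents:
  assumes thr: "threshold_graph (upper_ideal_relation_graph R)"
    and c: "a \<in> carrier R" "b \<in> carrier R" "c \<in> carrier R"
    and nz: "a \<noteq> \<zero>" "b \<noteq> \<zero>" "c \<noteq> \<zero>"
    and orth: "a \<otimes> b = \<zero>" "a \<otimes> c = \<zero>" "b \<otimes> c = \<zero>"
    and sum: "a \<oplus> b \<oplus> c = \<one>"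
  shows False
proof -
  let ?G = "upper_ideal_relation_graph R"
  have orth': "b \<otimes> a = \<zero>" "c \<otimes> a = \<zero>" "c \<otimes> b = \<zero>" using orth c by (simp_all add: m_comm)
  have sq: "a \<otimes> a = a" "c \<otimes> c = c"
    using idempotent_if_complementary[of a "b \<oplus> c"] idempotent_if_complementary[of c "a \<oplus> b"]
      c orth orth' sum by (simp_all add: r_distr a_ac)
  have nu: "a \<in> nonunits R" "c \<in> nonunits R" "a \<oplus> b \<in> nonunits R" "b \<oplus> c \<in> nonunits R"
    "a \<oplus> c \<in> nonunits R"
    using c nz orth orth' zero_divisor_nonunit[of a b] zero_divisor_nonunit[of c a]
      zero_divisor_nonunit[of "a \<oplus> b" c] zero_divisor_nonunit[of "b \<oplus> c" a]
      zero_divisor_nonunit[of "a \<oplus> c" b] by (simp_all add: l_distr)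
  have ne: "a \<oplus> b \<noteq> a" "c \<noteq> b \<oplus> c" "a \<noteq> c"
    using c nz orth sq by auto
  have arcs: "(a \<oplus> b, a) \<in> parcs ?G" "(a, c) \<in> parcs ?G" "(c, b \<oplus> c) \<in> parcs ?G"
  proof -
    have "(a \<oplus> b) divides a"
      using c sq orth' by (intro dividesI[where c = a]) (simp_all add: l_distr)
    then show "(a \<oplus> b, a) \<in> parcs ?G"
      using nu ne c by (auto simp: upper_ideal_relation_graph_arc_iff)
    \<comment> \<open>\<open>a \<oplus> c\<close> kills \<open>b\<close>, so it is a non-unit, and
      it divides both \<open>a\<close> and \<open>c\<close>.\<close>
    have "(a \<oplus> c) divides a" "(a \<oplus> c) divides c"
      using c sq orth orth'
      by (intro dividesI[where c = a] dividesI[where c = c]; simp add: l_distr)+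
    then show "(a, c) \<in> parcs ?G"
      using nu ne c by (auto simp: upper_ideal_relation_graph_arc_iff)
    have "(b \<oplus> c) divides c"
      using c sq orth by (intro dividesI[where c = c]) (simp_all add: l_distr)
    then show "(c, b \<oplus> c) \<in> parcs ?G"
      using nu ne c by (auto simp: upper_ideal_relation_graph_arc_iff)
  qed
  \<comment> \<open>Comaximality of the three non-adjacent pairs. In the middle one the factor
    \<open>a\<close> turns \<open>a \<oplus> b\<close> into \<open>a\<close>, so that
    \<open>b\<close> is counted only once.\<close>
  have "(a \<oplus> b) \<otimes> \<one> \<oplus> c \<otimes> \<one> = \<one>" "(a \<oplus> b) \<otimes> a \<oplus> (b \<oplus> c) \<otimes> \<one> = \<one>"
    "a \<otimes> \<one> \<oplus> (b \<oplus> c) \<otimes> \<one> = \<one>"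
    using c sq orth' sum by (simp_all add: l_distr a_assoc)
  note nonarcs = this[THEN comaximal_not_arc(1)[rotated 3]] this[THEN comaximal_not_arc(2)[rotated 3]]
  have "distinct [a \<oplus> b, a, c, b \<oplus> c]" using ne nonarcs nu c by auto
  from threshold_graph_no_P4[OF thr this arcs] nonarcs nu c show False by auto
qed

text \<open>
  If \<open>x \<noteq> e\<close> divides \<open>e\<close> and \<open>y \<noteq> f\<close> divides \<open>f\<close>, then \<open>{e, x}\<close> and \<open>{f, y}\<close> are edges with no
  edge between them.
\<close>

lemma threshold_complementary_idempotents:
  assumes thr: "threshold_graph (upper_ideal_relation_graph R)"
    and c: "e \<in> carrier R" "f \<in> carrier R" and nz: "e \<noteq> \<zero>" "f \<noteq> \<zero>"
    and ef: "e \<otimes> f = \<zero>" "e \<oplus> f = \<one>"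
  shows "(\<forall>x\<in>nonunits R. x divides e \<longrightarrow> x = e) \<or> (\<forall>y\<in>nonunits R. y divides f \<longrightarrow> y = f)"
proof (rule ccontr)
  let ?G = "upper_ideal_relation_graph R"
  assume "\<not> ?thesis"
  then obtain x y where x: "x \<in> nonunits R" "x divides e" "x \<noteq> e"
    and y: "y \<in> nonunits R" "y divides f" "y \<noteq> f" by meson
  have nu: "e \<in> nonunits R" "f \<in> nonunits R"
    using zero_divisor_nonunit[of e f] zero_divisor_nonunit[of f e] c nz ef
    by (simp_all add: m_comm)
  have arcs: "(e, x) \<in> parcs ?G" "(f, y) \<in> parcs ?G"
    using nu x y by (auto simp: upper_ideal_relation_graph_arc_iff nonunits_closed)
  \<comment> \<open>Divisors of \<open>e\<close> and of \<open>f\<close> are comaximal: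
    \<open>u \<otimes> s \<oplus> v \<otimes> t = e \<oplus> f = \<one>\<close>. This separates
    \<open>{e, x}\<close> from \<open>{f, y}\<close>.\<close>
  have nonarc: "u \<noteq> v \<and> (u, v) \<notin> parcs ?G"
    if u: "u \<in> nonunits R" "u divides e" and v: "v \<in> nonunits R" "v divides f" for u v
  proof -
    obtain s t where "s \<in> carrier R" "t \<in> carrier R" "e = u \<otimes> s" "f = v \<otimes> t"
      using u(2) v(2) by (meson dividesD)
    then show ?thesis using comaximal_not_arc[OF u(1), of s t v] ef(2) by simp
  qed
  have "distinct [e, x, f, y]" using nonarc nu x y c by auto
  from threshold_graph_no_2K2[OF thr this arcs] nonarc nu x y c show False by auto
qed

text \<open>The idempotent power \<open>g\<close> of \<open>e \<otimes> x\<close> splits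
  \<open>e\<close> into the orthogonal idempotents \<open>g\<close> and
  \<open>h = e \<ominus> g\<close>. With \<open>f\<close> there would be three nonzero ones, so
  \<open>g\<close> or \<open>h\<close> vanishes, and \<open>uniq\<close> settles both cases. For the
  \<open>f\<close> component, \<open>uniq\<close> forces \<open>e \<oplus> f \<otimes> x\<close> to
  be a unit of \<open>R\<close>, whose inverse also inverts \<open>f \<otimes> x\<close>.\<close>

lemma threshold_components:
  assumes fin: "finite (carrier R)" and thr: "threshold_graph (upper_ideal_relation_graph R)"
    and c: "e \<in> carrier R" "f \<in> carrier R" and nz: "e \<noteq> \<zero>" "f \<noteq> \<zero>"
    and ef: "e \<otimes> f = \<zero>" "e \<oplus> f = \<one>"
    and uniq: "\<And>x. \<lbrakk>x \<in> nonunits R; x divides e\<rbrakk> \<Longrightarrow> x = e"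
  shows "\<And>x. x \<in> carrier R \<Longrightarrow> e \<otimes> x = \<zero> \<or> e \<otimes> x = e"
    and "\<And>x. \<lbrakk>x \<in> carrier R; f \<otimes> x \<noteq> \<zero>\<rbrakk> \<Longrightarrow> \<exists>y\<in>carrier R. f \<otimes> x \<otimes> y = f"
proof -
  have ee: "e \<otimes> e = e" using idempotent_if_complementary[of e f] c ef by simp
  have ff: "f \<otimes> f = f" using idempotent_if_complementary[of f e] c ef by (simp add: m_comm a_comm)
  show "\<exists>y\<in>carrier R. f \<otimes> x \<otimes> y = f" if x: "x \<in> carrier R" "f \<otimes> x \<noteq> \<zero>" for x
  proof -
    let ?u = "e \<oplus> f \<otimes> x"
    have u: "?u \<in> carrier R" using c x by simp
    have "?u \<otimes> e = e \<otimes> e \<oplus> (e \<otimes> f) \<otimes> x" using c x by algebra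
    then have "?u divides e" using c x ee ef by (intro dividesI[where c = e]) simp_all
    moreover have "?u \<noteq> e" using c x by simp
    ultimately have "?u divides \<one>" using uniq[of ?u] nonunit_divides_iff[OF u] by metis
    then obtain y where y: "y \<in> carrier R" "\<one> = ?u \<otimes> y" by blast
    have "f = f \<otimes> (?u \<otimes> y)" using c by (simp flip: y(2))
    also have "\<dots> = (e \<otimes> f) \<otimes> y \<oplus> (f \<otimes> f) \<otimes> x \<otimes> y" using c x y(1) by algebra
    also have "\<dots> = f \<otimes> x \<otimes> y" using c x y(1) ef ff by simp
    finally show ?thesis using y(1) by (intro bexI[of _ y]) simp_all
  qed
  \<comment> \<open>Multiples of \<open>e\<close> are killed by \<open>f\<close>, hence non-units,
    so \<open>uniq\<close> applies to those dividing \<open>e\<close>.\<close>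
  have unit: "e \<otimes> x = e" if x: "x \<in> carrier R" "e \<otimes> x divides e" for x
  proof (rule uniq[OF _ x(2)])
    have "(e \<otimes> x) \<otimes> f = (e \<otimes> f) \<otimes> x" using c x by algebra
    then show "e \<otimes> x \<in> nonunits R"
      using zero_divisor_nonunit[of "e \<otimes> x" f] c x nz ef by simp
  qed
  show "e \<otimes> x = \<zero> \<or> e \<otimes> x = e" if x: "x \<in> carrier R" for x
  proof -
    let ?a = "e \<otimes> x"
    have a: "?a \<in> carrier R" "e \<otimes> ?a = ?a" using c x ee by (simp_all flip: m_assoc)
    obtain n :: nat where n: "0 < n" "?a [^] n \<otimes> ?a [^] n = ?a [^] n"
      using exists_idempotent_power[OF fin a(1)] by blast
    define b where "b = ?a [^] (n - 1)"
    define g where "g = ?a [^] n"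
    define h where "h = e \<ominus> g"
    have b: "b \<in> carrier R" using a by (simp add: b_def)
    have gab: "g = ?a \<otimes> b"
      using n(1) a(1) nat_pow_mult[OF a(1), of 1 "n - 1"] by (simp add: g_def b_def)
    have g_closed: "g \<in> carrier R" using a by (simp add: g_def)
    have "e \<otimes> g = (e \<otimes> e) \<otimes> x \<otimes> b" unfolding gab using c x b by algebra
    then have g: "g \<in> carrier R" "g \<otimes> g = g" "e \<otimes> g = g"
      using g_closed n ee gab by (simp_all flip: g_def)
    have h: "h \<in> carrier R" using g c by (simp add: h_def)
    consider "g = \<zero>" | "h = \<zero>" | "g \<noteq> \<zero>" "h \<noteq> \<zero>" by blast
    then show ?thesis
    proof cases
      \<comment> \<open>\<open>?a\<close> is nilpotent, so
        \<open>e \<otimes> (\<one> \<ominus> ?a)\<close> is \<open>e\<close> times a unit and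
        divides \<open>e\<close>; by \<open>unit\<close> it equals \<open>e\<close>, which makes
        \<open>?a\<close> zero.\<close>
      case 1
      then have "\<one> \<ominus> ?a \<in> Units R" using nilpotent_imp_one_minus_Units a(1) by (simp add: g_def)
      then obtain t where t: "t \<in> carrier R" "(\<one> \<ominus> ?a) \<otimes> t = \<one>" by (meson Units_r_inv_ex)
      have "e \<otimes> (\<one> \<ominus> ?a) \<otimes> t = e" using t a(1) c by (simp add: m_assoc)
      then have "e \<otimes> (\<one> \<ominus> ?a) divides e" using t(1) by (intro dividesI[where c = t]) simp_all
      then have "e \<otimes> (\<one> \<ominus> ?a) = e" using unit a(1) by simp
      moreover have "?a = e \<otimes> ?a" using a(2) by simp
      moreover have "e \<otimes> ?a = e \<ominus> e \<otimes> (\<one> \<ominus> ?a)" using a(1) c x by algebra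
      ultimately have "?a = e \<ominus> e" by simp
      then show ?thesis using c by simp
    next
      case 2
      then have "g = e" using c g by (simp add: h_def)
      then have "?a divides e" using b gab by (intro dividesI[where c = b]) simp_all
      then show ?thesis using unit[OF x] by simp
    next
      case 3
      have "g \<otimes> h = e \<otimes> g \<ominus> g \<otimes> g" unfolding h_def using c g(1) by algebra
      then have gh: "g \<otimes> h = \<zero>" using g by simp
      have "(e \<otimes> g) \<otimes> f = (e \<otimes> f) \<otimes> g" using c g(1) by algebra
      then have gf: "g \<otimes> f = \<zero>" using ef g by simp
      have "h \<otimes> f = e \<otimes> f \<ominus> g \<otimes> f" unfolding h_def using c g(1) by algebra
      then have hf: "h \<otimes> f = \<zero>" using ef gf by simp
      have "g \<oplus> h = e" unfolding h_def using c g(1) by algebra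
      then have "g \<oplus> h \<oplus> f = \<one>" using ef by simp
      then show ?thesis
        using threshold_no_three_orthogonal_idempotents[OF thr g(1) h c(2) 3 nz(2) gh gf hf] by blast
    qed
  qed
qed

section \<open>The product decomposition\<close>

lemma field_component:
  assumes f: "f \<in> carrier R" "f \<noteq> \<zero>" "f \<otimes> f = f"
    and inv: "\<And>x. \<lbrakk>x \<in> carrier R; f \<otimes> x \<noteq> \<zero>\<rbrakk> \<Longrightarrow> \<exists>y\<in>carrier R. f \<otimes> x \<otimes> y = f"
  shows "field (R\<lparr>carrier := {x \<in> carrier R. f \<otimes> x = x}, one := f\<rparr>)" (is "field ?K")
proof -
  have "abelian_group ?K"
  proof (rule abelian_groupI)
    fix x assume "x \<in> carrier ?K"
    then show "\<exists>y\<in>carrier ?K. y \<oplus>\<^bsub>?K\<^esub> x = \<zero>\<^bsub>?K\<^esub>"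
      using f by (intro bexI[of _ "\<ominus> x"]) (simp_all add: r_minus l_neg)
  qed (use f in \<open>simp_all add: r_distr a_ac\<close>)
  moreover have "comm_monoid ?K"
  proof (rule comm_monoidI)
    fix x y assume "x \<in> carrier ?K" "y \<in> carrier ?K"
    then show "x \<otimes>\<^bsub>?K\<^esub> y \<in> carrier ?K" using f by (simp flip: m_assoc)
  qed (use f in \<open>simp_all add: m_ac\<close>)
  ultimately have "cring ?K"
    by (rule cringI) (simp add: l_distr)
  then show ?thesis
  proof (rule cring.cring_fieldI2)
    show "\<zero>\<^bsub>?K\<^esub> \<noteq> \<one>\<^bsub>?K\<^esub>" using f by simp
    fix x assume "x \<in> carrier ?K" "x \<noteq> \<zero>\<^bsub>?K\<^esub>"
    then have x: "x \<in> carrier R" "f \<otimes> x = x" "x \<noteq> \<zero>" by simp_all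
    then obtain y where y: "y \<in> carrier R" "x \<otimes> y = f" using inv[of x] by auto
    \<comment> \<open>The inverse \<open>y\<close> need not lie in the component.
      \<open>f \<otimes> y\<close> does, and it still inverts \<open>x\<close> because
      \<open>f\<close> is idempotent.\<close>
    have "x \<otimes> (f \<otimes> y) = f \<otimes> (x \<otimes> y)" using x(1) y(1) f(1) by (simp add: m_ac)
    moreover have "f \<otimes> (f \<otimes> y) = f \<otimes> y" using y(1) f by (simp flip: m_assoc)
    ultimately show "\<exists>b\<in>carrier ?K. x \<otimes>\<^bsub>?K\<^esub> b = \<one>\<^bsub>?K\<^esub>"
      using y f by (intro bexI[of _ "f \<otimes> y"]) simp_all
  qed
qed

text \<open>Peirce decomposition: \<open>x\<close> goes to
  \<open>(e \<otimes> x, f \<otimes> x)\<close>, with the two-element component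
  \<open>{\<zero>, e}\<close> read as the integers 0 and 1 modulo 2.\<close>

lemma iso_Z2_times_component:
  assumes c: "e \<in> carrier R" "f \<in> carrier R" and nz: "e \<noteq> \<zero>"
    and ef: "e \<otimes> f = \<zero>" "e \<oplus> f = \<one>"
    and two: "\<And>x. x \<in> carrier R \<Longrightarrow> e \<otimes> x = \<zero> \<or> e \<otimes> x = e"
  shows "R \<simeq> RDirProd (residue_ring 2) (R\<lparr>carrier := {x \<in> carrier R. f \<otimes> x = x}, one := f\<rparr>)"
    (is "R \<simeq> RDirProd ?Z ?K")
proof -
  have ee: "e \<otimes> e = e" using idempotent_if_complementary[of e f] c ef by simp
  have ff: "f \<otimes> f = f" using idempotent_if_complementary[of f e] c ef by (simp add: m_comm a_comm)
  \<comment> \<open>Otherwise \<open>two\<close> gives \<open>e \<oplus> e = e\<close>, that is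
    \<open>e = \<zero>\<close>. Addition in the \<open>e\<close> component is thus addition modulo
    2.\<close>
  have e2: "e \<oplus> e = \<zero>"
    using two[of "e \<oplus> e"] c ee nz by (auto simp: r_distr)
  define h where "h x = (if e \<otimes> x = \<zero> then 0 else 1 :: int, f \<otimes> x)" for x
  have split: "x = e \<otimes> x \<oplus> f \<otimes> x" if "x \<in> carrier R" for x
    using that c ef by (simp flip: l_distr)
  have "h \<in> ring_iso R (RDirProd ?Z ?K)"
  proof (rule ring_iso_memI)
    fix x y assume xy: "x \<in> carrier R" "y \<in> carrier R"
    show "h x \<in> carrier (RDirProd ?Z ?K)"
      using xy c ff by (simp add: h_def RDirProd_carrier residue_ring_def flip: m_assoc)
    have "e \<otimes> (x \<otimes> y) = (e \<otimes> x) \<otimes> (e \<otimes> y)"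
      using xy c ee by (metis m_assoc m_closed m_comm)
    moreover have "f \<otimes> (x \<otimes> y) = (f \<otimes> x) \<otimes> (f \<otimes> y)"
      using xy c ff by (metis m_assoc m_closed m_comm)
    ultimately show "h (x \<otimes> y) = h x \<otimes>\<^bsub>RDirProd ?Z ?K\<^esub> h y"
      using two[OF xy(1)] two[OF xy(2)] xy c ee nz
      by (auto simp: h_def RDirProd_def DirProd_def monoid.defs residue_ring_def)
    show "h (x \<oplus> y) = h x \<oplus>\<^bsub>RDirProd ?Z ?K\<^esub> h y"
      using two[OF xy(1)] two[OF xy(2)] xy c e2 nz
      by (auto simp: h_def RDirProd_def DirProd_def monoid.defs residue_ring_def r_distr)
  next
    show "h \<one> = \<one>\<^bsub>RDirProd ?Z ?K\<^esub>"
      using c nz by (simp add: h_def RDirProd_def DirProd_def monoid.defs residue_ring_def)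
    have "inj_on h (carrier R)"
    proof (rule inj_onI)
      fix x y assume xy: "x \<in> carrier R" "y \<in> carrier R" "h x = h y"
      then have "e \<otimes> x = e \<otimes> y" "f \<otimes> x = f \<otimes> y"
        using two[of x] two[of y] by (auto simp: h_def split: if_splits)
      then show "x = y" using split[OF xy(1)] split[OF xy(2)] by simp
    qed
    moreover have "h ` carrier R = carrier (RDirProd ?Z ?K)"
    proof
      show "h ` carrier R \<subseteq> carrier (RDirProd ?Z ?K)"
        using c ff by (auto simp: h_def RDirProd_carrier residue_ring_def simp flip: m_assoc)
      show "carrier (RDirProd ?Z ?K) \<subseteq> h ` carrier R"
      proof
        fix p assume p: "p \<in> carrier (RDirProd ?Z ?K)"
        obtain i k where ik: "p = (i, k)" by fastforce
        have k: "k \<in> carrier R" "f \<otimes> k = k" and i: "i = 0 \<or> i = 1"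
          using p by (auto simp: ik RDirProd_carrier residue_ring_def)
        have fe: "f \<otimes> e = \<zero>" using c ef by (simp add: m_comm)
        have "e \<otimes> k = (e \<otimes> f) \<otimes> k" using c k by (simp add: m_assoc)
        then have ek: "e \<otimes> k = \<zero>" using ef k by simp
        \<comment> \<open>\<open>e\<close> kills \<open>k\<close> and \<open>f\<close> kills
          \<open>e\<close>, so adding \<open>e\<close> changes only the first coordinate.\<close>
        have "p = h (if i = 0 then k else e \<oplus> k)"
          using i k c ek ee fe nz by (auto simp: ik h_def r_distr)
        then show "p \<in> h ` carrier R" using c k by auto
      qed
    qed
    ultimately show "bij_betw h (carrier R) (carrier (RDirProd ?Z ?K))"
      by (simp add: bij_betw_def)
  qed
  then show ?thesis by (auto simp: is_ring_iso_def)
qed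

lemma threshold_imp_iso_Z2_times_field:
  assumes fin: "finite (carrier R)" and thr: "threshold_graph (upper_ideal_relation_graph R)"
    and nonlocal: "\<one> \<noteq> \<zero>" "\<not> local_ring R"
  shows "\<exists>F :: nat ring. field F \<and> finite (carrier F) \<and> R \<simeq> RDirProd (residue_ring 2) F"
proof -
  obtain e f where ef: "e \<in> carrier R" "f \<in> carrier R" "e \<noteq> \<zero>" "f \<noteq> \<zero>" "e \<otimes> f = \<zero>" "e \<oplus> f = \<one>"
    using nonlocal_obtains_idempotents[OF fin nonlocal] .
  \<comment> \<open>Stated for any complementary pair, since either idempotent may be the one with
    no other non-unit divisor.\<close>
  have main: ?thesis
    if c: "e \<in> carrier R" "f \<in> carrier R" and nz: "e \<noteq> \<zero>" "f \<noteq> \<zero>"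
      and ef: "e \<otimes> f = \<zero>" "e \<oplus> f = \<one>" and uniq: "\<forall>x\<in>nonunits R. x divides e \<longrightarrow> x = e" for e f
  proof -
    note comp = threshold_components[OF fin thr c nz ef uniq[rule_format]]
    let ?K = "R\<lparr>carrier := {x \<in> carrier R. f \<otimes> x = x}, one := f\<rparr>"
    have ff: "f \<otimes> f = f" using idempotent_if_complementary[of f e] c ef by (simp add: m_comm a_comm)
    have "field ?K" using field_component[OF c(2) nz(2) ff comp(2)] .
    moreover have "finite (carrier ?K)" using fin by simp
    \<comment> \<open>The component has the element type of \<open>R\<close>, so it is replaced by
      an isomorphic field on naturals.\<close>
    ultimately obtain F :: "nat ring" where F: "field F" "finite (carrier F)" "?K \<simeq> F"
      using finite_field_nat_copy by blast
    have "RDirProd (residue_ring 2) ?K \<simeq> RDirProd (residue_ring 2) F"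
      using F(3) RDirProd_iso5 by (fastforce simp: is_ring_iso_def)
    then show ?thesis
      using F ring_iso_trans[OF iso_Z2_times_component[OF c nz(1) ef comp(1)]] by blast
  qed
  show ?thesis
    using threshold_complementary_idempotents[OF thr ef]
  proof
    assume "\<forall>y\<in>nonunits R. y divides f \<longrightarrow> y = f"
    then show ?thesis using main[of f e] ef by (simp add: m_comm a_comm)
  qed (rule main[OF ef])
qed

text \<open>
  Every non-unit other than the preimage of \<open>(1, 0)\<close> is a multiple of the preimage of \<open>(0, 1)\<close>.
\<close>

lemma threshold_if_iso_Z2_times_field:
  fixes F :: "('c, 'd) ring_scheme"
  assumes fin: "finite (carrier R)" and F: "field F" and iso: "R \<simeq> RDirProd (residue_ring 2) F"
  shows "threshold_graph (upper_ideal_relation_graph R)"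
proof -
  let ?P = "RDirProd (residue_ring 2) F"
  interpret F: field F by fact
  obtain h where h: "h \<in> ring_iso R ?P" using iso by (auto simp: is_ring_iso_def)
  note hE = ring_iso_memE[OF h]
  have P: "carrier ?P = {0, 1} \<times> carrier F"
    "(i, a) \<otimes>\<^bsub>?P\<^esub> (j, b) = (i * j mod 2, a \<otimes>\<^bsub>F\<^esub> b)" "\<one>\<^bsub>?P\<^esub> = (1, \<one>\<^bsub>F\<^esub>)" for i j a b
    by (auto simp: RDirProd_def DirProd_def monoid.defs residue_ring_def)
  have inj: "x = y" if "x \<in> carrier R" "y \<in> carrier R" "h x = h y" for x y
    using hE(5) that by (auto simp: bij_betw_def dest: inj_onD)
  have surj: "\<exists>x\<in>carrier R. h x = p" if "p \<in> carrier ?P" for p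
    using bij_betw_imp_surj_on[OF hE(5)] that by (metis imageE)
  obtain e where e: "e \<in> carrier R" "h e = (0, \<one>\<^bsub>F\<^esub>)" using surj[of "(0, \<one>\<^bsub>F\<^esub>)"] P by auto
  obtain w where w: "w \<in> carrier R" "h w = (1, \<zero>\<^bsub>F\<^esub>)" using surj[of "(1, \<zero>\<^bsub>F\<^esub>)"] P by auto
  have "\<not> e divides \<one>"
  proof
    assume "e divides \<one>"
    then obtain t where t: "t \<in> carrier R" "\<one> = e \<otimes> t" by blast
    then have "(1, \<one>\<^bsub>F\<^esub>) = (0, \<one>\<^bsub>F\<^esub>) \<otimes>\<^bsub>?P\<^esub> h t" using hE(2,4) e P(3) by metis
    then show False by (cases "h t") (simp add: P)
  qed
  then have e_nonunit: "e \<in> nonunits R" using e by (simp add: nonunit_divides_iff)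
  have mult: "e divides x" if x: "x \<in> nonunits R" "x \<noteq> w" for x
  proof -
    have xc: "x \<in> carrier R" using x by (simp add: nonunits_closed)
    obtain i y where iy: "h x = (i, y)" by fastforce
    have y: "i = 0 \<or> i = 1" "y \<in> carrier F" using hE(1)[OF xc] P by (auto simp: iy)
    \<comment> \<open>With first coordinate 1, \<open>x \<noteq> w\<close> makes \<open>y\<close>
      nonzero, and \<open>(1, y^-1)\<close> would invert \<open>h x\<close>.\<close>
    have "i \<noteq> 1"
    proof
      assume i: "i = 1"
      then have "y \<noteq> \<zero>\<^bsub>F\<^esub>" using inj[OF xc w(1)] x(2) w(2) iy by auto
      then have "y \<in> Units F" using y(2) F.field_Units by simp
      then obtain t where t: "t \<in> carrier R" "h t = (1, inv\<^bsub>F\<^esub> y)"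
        using surj[of "(1, inv\<^bsub>F\<^esub> y)"] P by auto
      have "h (x \<otimes> t) = h \<one>"
        using hE(2)[OF xc t(1)] hE(4) \<open>y \<in> Units F\<close> by (simp add: iy t P i)
      then have "\<one> = x \<otimes> t" using inj xc t(1) by (metis m_closed one_closed)
      then have "x divides \<one>" using t(1) by (intro dividesI)
      then show False using x(1) xc by (simp add: nonunit_divides_iff)
    qed
    \<comment> \<open>So \<open>i = 0\<close>, and multiplication by \<open>(0, 1)\<close> fixes
      \<open>h x\<close>.\<close>
    then have "h (e \<otimes> x) = h x" using hE(2)[OF e(1) xc] y by (simp add: iy e P)
    then have "x = e \<otimes> x" using inj e(1) xc by (metis m_closed)
    then show ?thesis using xc by (intro dividesI)
  qed
  show ?thesis
  proof (rule threshold_graph_if_clique_but_one[of _ w])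
    show "pair_graph (upper_ideal_relation_graph R)"
      using fin by (rule pair_graph_upper_ideal_relation_graph)
    fix x y
    assume "x \<in> pverts (upper_ideal_relation_graph R) - {w}"
      "y \<in> pverts (upper_ideal_relation_graph R) - {w}" and "x \<noteq> y"
    then show "(x, y) \<in> parcs (upper_ideal_relation_graph R)"
      using mult[of x] mult[of y] e_nonunit
      unfolding upper_ideal_relation_graph_arc_iff by (intro conjI bexI[of _ e]) simp_all
  qed
qed

end

theorem theorem3p2:
  fixes R :: "('a, 'm) ring_scheme"
  assumes "cring R"
    and "finite (carrier R)"
    and "\<one>\<^bsub>R\<^esub> \<noteq> \<zero>\<^bsub>R\<^esub>"
    and "\<not> local_ring R"
  shows "threshold_graph (upper_ideal_relation_graph R) \<longleftrightarrow>
    (\<exists>F :: nat ring. field F \<and> finite (carrier F) \<and> R \<simeq> RDirProd (residue_ring 2) F)"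
proof -
  interpret cring R by fact
  show ?thesis
  proof
    assume "threshold_graph (upper_ideal_relation_graph R)"
    then show "\<exists>F :: nat ring. field F \<and> finite (carrier F) \<and> R \<simeq> RDirProd (residue_ring 2) F"
      by (rule threshold_imp_iso_Z2_times_field[OF assms(2) _ assms(3,4)])
  next
    assume "\<exists>F :: nat ring. field F \<and> finite (carrier F) \<and> R \<simeq> RDirProd (residue_ring 2) F"
    then obtain F :: "nat ring" where "field F" "R \<simeq> RDirProd (residue_ring 2) F" by blast
    then show "threshold_graph (upper_ideal_relation_graph R)"
      by (rule threshold_if_iso_Z2_times_field[OF assms(2)])
  qed
qed

end
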